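(* For $n, m \in \mathbb{N}$, let $kr_4(n,m)$ be the number of partitions $\lambda_1 \le \lambda_2 \le \cdots \le \lambda_m$ of $n$ into $m$ parts with smallest part at least two, and difference at least three at distance two, such that if two successive parts differ by at most one, then their sum is $\equiv 2 \pmod{3}$. Then $$\sum_{n, m \geq 0} kr_4(n, m)\, q^n x^m = \sum_{n_1, n_2 \geq 0} \frac{ q^{3n_2^2 + 2n_2 + n_1^2 + n_1 + 3n_1n_2}\, x^{2n_2 + n_1} }{ (q; q)_{n_1} (q^3; q^3)_{n_2} }.$$
   Context: $\mathbb{N}=\{0,1,2,\dots\}$. A partition of $n$ into $m$ parts is a non-decreasing sequence $\lambda_1 \le \cdots \le \lambda_m$ of positive integers with sum $n$ (the empty partition is the unique partition of $0$, with $m=0$; it satisfies all the conditions vacuously). "Difference at least $k$ at distance $d$" means $\lambda_{j+d}-\lambda_j \ge k$ for all $1 \le j \le m-d$. "Successive parts" are $\lambda_j$ and $\lambda_{j+1}$. The $q$-Pochhammer symbol is $(a;q)_n = \prod_{j=1}^{n}(1-aq^{j-1})$, with $(a;q)_0=1$. The identity is one of formal power series in $q$ and $x$. *)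

theory Defs
  imports "HOL-Analysis.Infinite_Sum" "HOL-Computational_Algebra.Formal_Power_Series"
begin

text \<open>A partition of \<open>n\<close> into \<open>m\<close> parts is a non-decreasing list; since lists are
  indexed from 0, the part written \<open>\<lambda>\<^sub>j\<close> (with \<open>j \<ge> 1\<close>) is \<open>ps ! (j - 1)\<close>.\<close>

definition is_partition :: "nat \<Rightarrow> nat \<Rightarrow> nat list \<Rightarrow> bool" where
  "is_partition n m ps \<longleftrightarrow>
     length ps = m \<and> sorted ps \<and> (\<forall>p \<in> set ps. 0 < p) \<and> sum_list ps = n"

text \<open>The differences below are written additively, which avoids truncated subtraction on
  \<open>nat\<close>.\<close>

definition diff_at_dist :: "nat \<Rightarrow> nat \<Rightarrow> nat list \<Rightarrow> bool" where
  "diff_at_dist k d ps \<longleftrightarrow> (\<forall>j. j + d < length ps \<longrightarrow> ps ! (j + d) \<ge> ps ! j + k)"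

definition kr4_partitions :: "nat \<Rightarrow> nat \<Rightarrow> nat list set" where
  "kr4_partitions n m =
     {ps. is_partition n m ps \<and>
          (\<forall>p \<in> set ps. 2 \<le> p) \<and>
          diff_at_dist 3 2 ps \<and>
          (\<forall>j. j + 1 < length ps \<longrightarrow> ps ! (j + 1) \<le> ps ! j + 1 \<longrightarrow>
               (ps ! j + ps ! (j + 1)) mod 3 = 2)}"

lemma finite_kr4_partitions: "finite (kr4_partitions n m)"
proof (rule finite_subset)
  show "kr4_partitions n m \<subseteq> {ps. set ps \<subseteq> {..n} \<and> length ps = m}"
    by (auto simp: kr4_partitions_def is_partition_def intro: member_le_sum_list)
qed (rule finite_lists_length_eq, simp)

definition kr4 :: "nat \<Rightarrow> nat \<Rightarrow> nat" where
  "kr4 n m = card (kr4_partitions n m)"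

definition qpochhammer :: "'a \<Rightarrow> 'a \<Rightarrow> nat \<Rightarrow> 'a :: comm_ring_1" where
  "qpochhammer a q n = (\<Prod>j = 1..n. 1 - a * q ^ (j - 1))"

text \<open>Bivariate series are elements of \<open>rat fps fps\<close>, that is, power series in \<open>q\<close> whose
  coefficients are power series in \<open>x\<close>. Infinite sums refer to the \<open>q\<close>-adic topology carried
  by this type (a sum converges iff, for each \<open>N\<close>, almost all summands are divisible by
  \<open>q ^ N\<close>). With the roles of \<open>q\<close> and \<open>x\<close> exchanged, the sums would not converge:
  infinitely many summands share the same power of \<open>x\<close>.\<close>

definition q_var :: "rat fps fps" where "q_var = fps_X"

definition x_var :: "rat fps fps" where "x_var = fps_const fps_X"

text \<open>\<open>rat fps\<close> is not a field, so the general lemmas about division in \<open>'a fps\<close> do not apply.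
  The quotients by \<open>(q; q)\<^sub>n\<close> and \<open>(q\<^sup>3; q\<^sup>3)\<^sub>n\<close> are nevertheless true quotients, as
  both have constant coefficient 1.\<close>

lemma qpochhammer_nth_0:
  fixes a b :: "rat fps fps"
  assumes "fps_nth a 0 = 0"
  shows "fps_nth (qpochhammer a b n) 0 = 1"
  by (induction n) (simp_all add: qpochhammer_def assms)

lemma divide_mult_cancel_rat_fps_fps:
  fixes f g :: "rat fps fps"
  assumes "fps_nth g 0 = 1"
  shows "f / g * g = f"
proof -
  have inv1: "inverse (1 :: rat fps) = 1"
    by simp
  have "inverse g = fps_right_inverse g 1"
    by (subst fps_inverse_def) (simp only: assms inv1)
  moreover have "g * fps_right_inverse g 1 = 1"
    by (rule fps_right_inverse) (simp add: assms)
  ultimately have "inverse g * g = 1"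
    by (simp add: mult.commute)
  moreover have "f / g = f * inverse g"
    by (rule fps_divide_unit) (simp add: assms)
  ultimately show ?thesis
    by (simp add: mult.assoc)
qed

lemma qpochhammer_quotients:
  fixes f :: "rat fps fps"
  shows "f / (qpochhammer q_var q_var m * qpochhammer (q_var ^ 3) (q_var ^ 3) n) *
         (qpochhammer q_var q_var m * qpochhammer (q_var ^ 3) (q_var ^ 3) n) = f"
  by (rule divide_mult_cancel_rat_fps_fps)
     (simp add: qpochhammer_nth_0 q_var_def)

end

theory Submission
  imports Defs
begin

text \<open>
  Let \<open>F\<^sub>s(x)\<close> be the generating function, with \<open>q\<close> marking the sum and \<open>x\<close> the number of parts, of
  the lists that satisfy the difference and congruence conditions and have all parts at least
  \<open>s\<close>. The left-hand side of the identity is \<open>F\<^sub>2(x)\<close>. Two facts determine it.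

  First, the parts close to the smallest one can be split off. If two successive parts differ by
  at most one, the congruence forces them to be \<open>(3k + 1, 3k + 1)\<close> or \<open>(3k + 2, 3k + 3)\<close>, so for
  each of the smallest parts 2, 3 and 4 there are only few possibilities for the next part, and the
  remainder of the list is constrained only by a lower bound. This gives
  \<open>F\<^sub>2 = F\<^sub>3 + x q\<^sup>2 F\<^sub>5 + x\<^sup>2 q\<^sup>6 F\<^sub>6 + x\<^sup>2 q\<^sup>5 F\<^sub>5\<close>,
  \<open>F\<^sub>3 = F\<^sub>4 + x q\<^sup>3 F\<^sub>5\<close> and
  \<open>F\<^sub>4 = F\<^sub>5 + x q\<^sup>4 F\<^sub>6 + x\<^sup>2 q\<^sup>8 F\<^sub>7\<close>.
  Second, adding 3 to all parts changes the sum of two parts by 6 and so preserves all conditions;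
  hence \<open>F\<close> with index \<open>s + 3\<close> is \<open>F\<^sub>s(x q\<^sup>3)\<close>, and the three equations form a closed system in
  \<open>F\<^sub>2\<close>, \<open>F\<^sub>3\<close>, \<open>F\<^sub>4\<close> (lemma \<open>kr4_system_list_gf\<close>).

  That system has at most one solution with \<open>F\<^sub>2(0) = 1\<close>: the coefficients of \<open>x\<^sup>m\<close> are determined by
  the earlier ones up to a linear equation with the factor \<open>1 - q\<^bsup>3m\<^esup>\<close>, which is non-zero for
  \<open>m > 0\<close> (lemma \<open>kr4_system_unique\<close>).

  It remains to find the solution among the double series
  \<open>H(a, b) = \<Sum> q\<^bsup>3j\<^sup>2 + i\<^sup>2 + 3ij + ai + bj\<^esup> x\<^bsup>i + 2j\<^esup> / ((q; q)\<^sub>i (q\<^sup>3; q\<^sup>3)\<^sub>j)\<close>.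
  Multiplying the summands by \<open>1 - q\<^sup>i\<close> or by \<open>1 - q\<^bsup>3j\<^esup>\<close> cancels a factor of the denominator,
  and the index shift that follows yields two contiguity relations,
  \<open>H(a, b) = H(a + 1, b) + x q\<^bsup>a + 1\<^esup> H(a + 2, b + 3)\<close> and
  \<open>H(a, b) = H(a, b + 3) + x\<^sup>2 q\<^bsup>b + 3\<^esup> H(a + 3, b + 6)\<close>. They imply that
  \<open>H(1, 2)\<close>, \<open>H(2, 5)\<close>, \<open>H(3, 5)\<close> solve the system (lemma \<open>kr4_system_double_series\<close>). These
  parameters can be guessed from the lowest terms: \<open>i = 1\<close>, \<open>j = 0\<close> must produce the smallest single
  part, so \<open>1 + a\<close> is 2, 3, 4; and \<open>i = 0\<close>, \<open>j = 1\<close> must produce the smallest close pair,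
  \<open>(2, 3)\<close> or \<open>(4, 4)\<close>, so \<open>3 + b\<close> is 5, 8, 8.
\<close>

section \<open>Admissible lists and how they begin\<close>

text \<open>The recursive form of the conditions on \<open>kr4_partitions\<close> other than the lower bound 2. The
  condition at distance two is a quantification over the at most one element of \<open>take 1 ps\<close>, so
  that lists of length two need no equation of their own.\<close>

fun admissible :: "nat list \<Rightarrow> bool" where
  "admissible [] \<longleftrightarrow> True"
| "admissible [a] \<longleftrightarrow> True"
| "admissible (a # b # ps) \<longleftrightarrow>
     a \<le> b \<and> (b \<le> a + 1 \<longrightarrow> (a + b) mod 3 = 2) \<and> (\<forall>p \<in> set (take 1 ps). a + 3 \<le> p) \<and>
     admissible (b # ps)"

lemma All_nat_split: "(\<forall>j::nat. P j) \<longleftrightarrow> P 0 \<and> (\<forall>j. P (Suc j))"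
  by (metis not0_implies_Suc)

lemma diff_at_dist_2_Cons_Cons:
  "diff_at_dist k 2 (a # b # ps) \<longleftrightarrow>
     (\<forall>p \<in> set (take 1 ps). a + k \<le> p) \<and> diff_at_dist k 2 (b # ps)"
  unfolding diff_at_dist_def by (subst All_nat_split, cases ps) simp_all

lemma admissible_iff:
  "admissible ps \<longleftrightarrow> sorted ps \<and> diff_at_dist 3 2 ps \<and>
     (\<forall>j. j + 1 < length ps \<longrightarrow> ps ! (j + 1) \<le> ps ! j + 1 \<longrightarrow>
        (ps ! j + ps ! (j + 1)) mod 3 = 2)"
proof (induction ps rule: admissible.induct)
  case (3 a b ps)
  have succ: "(\<forall>j. j + 1 < length (a # b # ps) \<longrightarrow> (a # b # ps) ! (j + 1) \<le> (a # b # ps) ! j + 1 \<longrightarrow>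
          ((a # b # ps) ! j + (a # b # ps) ! (j + 1)) mod 3 = 2) \<longleftrightarrow>
        (b \<le> a + 1 \<longrightarrow> (a + b) mod 3 = 2) \<and>
        (\<forall>j. j + 1 < length (b # ps) \<longrightarrow> (b # ps) ! (j + 1) \<le> (b # ps) ! j + 1 \<longrightarrow>
          ((b # ps) ! j + (b # ps) ! (j + 1)) mod 3 = 2)" (is "(\<forall>j. ?P j) \<longleftrightarrow> ?A \<and> (\<forall>j. ?Q j)")
  proof -
    have "(\<forall>j. ?P j) \<longleftrightarrow> ?P 0 \<and> (\<forall>j. ?P (Suc j))"
      by (rule All_nat_split)
    then show ?thesis by simp
  qed
  show ?case
    unfolding succ diff_at_dist_2_Cons_Cons admissible.simps(3) 3 sorted2 by blast
qed (simp_all add: diff_at_dist_def)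

lemma admissible_Cons_le:
  assumes "admissible (a # ps)" "p \<in> set ps"
  shows "a \<le> p"
  using assms by (auto simp: admissible_iff)

definition admissible_from :: "nat \<Rightarrow> nat list set" where
  "admissible_from s = {ps. admissible ps \<and> (\<forall>p \<in> set ps. s \<le> p)}"

text \<open>Since admissible lists are sorted, the lower bound needs to be checked for the head only.\<close>

lemma admissible_from_Cons_iff:
  "a # ps \<in> admissible_from s \<longleftrightarrow> admissible (a # ps) \<and> s \<le> a"
  using admissible_Cons_le by (fastforce simp: admissible_from_def)

lemma admissible_from_Suc:
  "admissible_from s = admissible_from (Suc s) \<union> {ps. admissible ps \<and> (\<exists>qs. ps = s # qs)}"
proof (rule set_eqI)
  fix ps
  show "ps \<in> admissible_from s \<longleftrightarrow>
    ps \<in> admissible_from (Suc s) \<union> {ps. admissible ps \<and> (\<exists>qs. ps = s # qs)}"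
    by (cases ps) (auto simp: admissible_from_Cons_iff, simp_all add: admissible_from_def)
qed

lemma Nil_in_admissible_from: "[] \<in> admissible_from s"
  by (simp add: admissible_from_def)

lemma admissible_Cons3_iff:
  "admissible (a # b # c # ps) \<longleftrightarrow>
     a \<le> b \<and> (b \<le> a + 1 \<longrightarrow> (a + b) mod 3 = 2) \<and> a + 3 \<le> c \<and> admissible (b # c # ps)"
  by simp

text \<open>A close pair beginning with 3 would have sum 6 or 7, neither congruent to 2 modulo 3, so the
  next part is at least 5. The condition at distance two then holds automatically, because the only
  violation left, \<open>3, 5, 5\<close>, contains the forbidden pair \<open>5, 5\<close>.\<close>

lemma admissible_3_Cons_iff: "admissible (3 # ps) \<longleftrightarrow> ps \<in> admissible_from 5"
proof -
  have fst_part: "3 \<le> b \<and> (b \<le> 3 + 1 \<longrightarrow> (3 + b) mod 3 = 2) \<longleftrightarrow> 5 \<le> b" for b :: nat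
    by presburger
  show ?thesis
  proof (cases ps rule: admissible.cases)
    case (2 b)
    then show ?thesis
      using fst_part[of b] by (simp add: admissible_from_Cons_iff)
  next
    case (3 b c rs)
    have "3 + 3 \<le> c" if "5 \<le> b" "b \<le> c" "c \<le> b + 1 \<longrightarrow> (b + c) mod 3 = 2"
    proof (rule ccontr)
      assume "\<not> 3 + 3 \<le> c"
      with that have "b = 5" "c = 5" by linarith+
      with that show False by simp
    qed
    with fst_part[of b] show ?thesis
      unfolding 3 admissible_from_Cons_iff admissible_Cons3_iff[of 3] admissible.simps(3)[of b]
      by blast
  qed (simp add: Nil_in_admissible_from)
qed

text \<open>The only close pair beginning with 4 is \<open>4, 4\<close>. After it, the condition at distance two forces
  parts of size at least 7, which is also sufficient for it. Any other second part is at least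
  6, and the third one then exceeds 6 because the pair \<open>6, 6\<close> is forbidden.\<close>

lemma admissible_4_Cons_iff:
  "admissible (4 # ps) \<longleftrightarrow>
     ps \<in> admissible_from 6 \<or> (\<exists>rs. ps = 4 # rs \<and> rs \<in> admissible_from 7)"
proof -
  have fst_part: "4 \<le> b \<and> (b \<le> 4 + 1 \<longrightarrow> (4 + b) mod 3 = 2) \<longleftrightarrow> 6 \<le> b \<or> b = 4" for b :: nat
    by presburger
  show ?thesis
  proof (cases ps rule: admissible.cases)
    case (2 b)
    then show ?thesis
      using fst_part[of b] by (auto simp: admissible_from_Cons_iff Nil_in_admissible_from)
  next
    case ps: (3 b c rs)
    have far: "4 + 3 \<le> c" if "6 \<le> b" "b \<le> c" "c \<le> b + 1 \<longrightarrow> (b + c) mod 3 = 2"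
    proof (rule ccontr)
      assume "\<not> 4 + 3 \<le> c"
      with that have "b = 6" "c = 6" by linarith+
      with that show False by simp
    qed
    have "admissible (4 # c # rs) \<longleftrightarrow> admissible (c # rs)" if "7 \<le> c"
      using that admissible_Cons_le[of c rs] by (cases rs) auto
    then have 4: "b = 4 \<and> 4 + 3 \<le> c \<and> admissible (b # c # rs) \<longleftrightarrow> b = 4 \<and> c # rs \<in> admissible_from 7"
      by (auto simp: admissible_from_Cons_iff)
    have 6: "6 \<le> b \<and> 4 + 3 \<le> c \<and> admissible (b # c # rs) \<longleftrightarrow> 6 \<le> b \<and> admissible (b # c # rs)"
      unfolding admissible.simps(3)[of b] using far by blast
    have "admissible (4 # ps) \<longleftrightarrow> (4 \<le> b \<and> (b \<le> 4 + 1 \<longrightarrow> (4 + b) mod 3 = 2)) \<and>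
        4 + 3 \<le> c \<and> admissible (b # c # rs)"
      by (simp only: ps admissible_Cons3_iff[of 4] conj_assoc)
    also have "\<dots> \<longleftrightarrow> (6 \<le> b \<and> 4 + 3 \<le> c \<and> admissible (b # c # rs)) \<or>
        (b = 4 \<and> 4 + 3 \<le> c \<and> admissible (b # c # rs))"
      unfolding fst_part by blast
    also have "\<dots> \<longleftrightarrow> ps \<in> admissible_from 6 \<or> (\<exists>us. ps = 4 # us \<and> us \<in> admissible_from 7)"
      unfolding 4 6 unfolding ps admissible_from_Cons_iff[of b] by blast
    finally show ?thesis .
  qed (simp add: Nil_in_admissible_from)
qed

text \<open>A third part after 2 has to be at least 5. If the second part is 4, this excludes the pair
  \<open>4, 4\<close>; together with the forbidden pair \<open>4, 5\<close> it pushes the third part up to 6. If the second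
  part is 3, the bound 5 is already implied by the rules for lists beginning with 3.\<close>

lemma admissible_2_Cons_iff:
  "admissible (2 # ps) \<longleftrightarrow>
     ps \<in> admissible_from 5 \<or> (\<exists>rs. ps = 4 # rs \<and> rs \<in> admissible_from 6) \<or>
     (\<exists>rs. ps = 3 # rs \<and> rs \<in> admissible_from 5)"
proof -
  have fst_part: "2 \<le> b \<and> (b \<le> 2 + 1 \<longrightarrow> (2 + b) mod 3 = 2) \<longleftrightarrow> 5 \<le> b \<or> b = 4 \<or> b = 3" for b :: nat
    by presburger
  show ?thesis
  proof (cases ps rule: admissible.cases)
    case (2 b)
    then show ?thesis
      using fst_part[of b] by (auto simp: admissible_from_Cons_iff Nil_in_admissible_from)
  next
    case ps: (3 b c rs)
    have "4 # c # rs \<in> admissible_from 4 \<and> 5 \<le> c \<longleftrightarrow> c # rs \<in> admissible_from 6"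
      by (auto simp: admissible_from_Cons_iff admissible_4_Cons_iff simp del: admissible.simps)
    then have 4: "b = 4 \<and> 2 + 3 \<le> c \<and> admissible (b # c # rs) \<longleftrightarrow> b = 4 \<and> c # rs \<in> admissible_from 6"
      by (auto simp: admissible_from_Cons_iff)
    have 3: "b = 3 \<and> 2 + 3 \<le> c \<and> admissible (b # c # rs) \<longleftrightarrow> b = 3 \<and> c # rs \<in> admissible_from 5"
      by (auto simp: admissible_from_Cons_iff admissible_3_Cons_iff simp del: admissible.simps)
    have 5: "5 \<le> b \<and> 2 + 3 \<le> c \<and> admissible (b # c # rs) \<longleftrightarrow> 5 \<le> b \<and> admissible (b # c # rs)"
      using admissible_Cons_le[of b "c # rs" c] by (auto simp del: admissible.simps)
    have "admissible (2 # ps) \<longleftrightarrow> (2 \<le> b \<and> (b \<le> 2 + 1 \<longrightarrow> (2 + b) mod 3 = 2)) \<and>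
        2 + 3 \<le> c \<and> admissible (b # c # rs)"
      by (simp only: ps admissible_Cons3_iff[of 2] conj_assoc)
    also have "\<dots> \<longleftrightarrow> (5 \<le> b \<and> 2 + 3 \<le> c \<and> admissible (b # c # rs)) \<or>
        (b = 4 \<and> 2 + 3 \<le> c \<and> admissible (b # c # rs)) \<or>
        (b = 3 \<and> 2 + 3 \<le> c \<and> admissible (b # c # rs))"
      unfolding fst_part by blast
    also have "\<dots> \<longleftrightarrow> ps \<in> admissible_from 5 \<or> (\<exists>us. ps = 4 # us \<and> us \<in> admissible_from 6) \<or>
        (\<exists>us. ps = 3 # us \<and> us \<in> admissible_from 5)"
      unfolding 3 4 5 unfolding ps admissible_from_Cons_iff[of b] by blast
    finally show ?thesis .
  qed (simp add: Nil_in_admissible_from)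
qed

text \<open>The resulting decompositions are disjoint unions; they become the functional equations.\<close>

lemma admissible_from_3:
  "admissible_from 3 = admissible_from 4 \<union> (Cons 3) ` admissible_from 5"
  by (subst admissible_from_Suc) (auto simp: admissible_3_Cons_iff simp del: admissible.simps)

lemma admissible_from_4:
  "admissible_from 4 = admissible_from 5 \<union> (Cons 4) ` admissible_from 6
     \<union> (Cons 4) ` (Cons 4) ` admissible_from 7"
  by (subst admissible_from_Suc) (auto simp: admissible_4_Cons_iff simp del: admissible.simps)

lemma admissible_from_2:
  "admissible_from 2 = admissible_from 3 \<union> (Cons 2) ` admissible_from 5
     \<union> (Cons 2) ` (Cons 4) ` admissible_from 6 \<union> (Cons 2) ` (Cons 3) ` admissible_from 5"
  by (subst admissible_from_Suc) (auto simp: admissible_2_Cons_iff simp del: admissible.simps)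

text \<open>The congruence condition survives because the sum of two parts grows by 6.\<close>

lemma admissible_shift: "admissible (map (\<lambda>p. p + 3) ps) \<longleftrightarrow> admissible ps"
proof (induction ps rule: admissible.induct)
  case (3 a b ps)
  have "(a + 3 + (b + 3)) mod 3 = (a + b) mod 3"
    by presburger
  with 3 show ?case
    by (simp add: take_map add.commute)
qed auto

lemma admissible_from_add_3:
  "admissible_from (s + 3) = map (\<lambda>p. p + 3) ` admissible_from s"
proof (intro equalityI subsetI)
  fix ps assume ps: "ps \<in> admissible_from (s + 3)"
  define qs where "qs = map (\<lambda>p. p - 3) ps"
  have qs: "map (\<lambda>p. p + 3) qs = ps"
    using ps by (auto simp: admissible_from_def qs_def intro!: map_idI)
  then have "qs \<in> admissible_from s"
    using ps admissible_shift[of qs] by (auto simp: admissible_from_def)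
  with qs show "ps \<in> map (\<lambda>p. p + 3) ` admissible_from s"
    by (metis imageI)
qed (auto simp: admissible_from_def admissible_shift)

section \<open>Generating functions of sets of lists\<close>

text \<open>The functional equations are solved degree by degree in \<open>x\<close>. Up to the last section, \<open>x\<close>
  is therefore the outer variable of \<open>rat fps fps\<close>, in contrast to \<open>x_var\<close> and \<open>q_var\<close>: the
  coefficient of \<open>x\<^sup>m\<close> is a univariate series in \<open>q\<close>.\<close>

abbreviation x_outer :: "rat fps fps" where "x_outer \<equiv> fps_X"

abbreviation q_inner :: "rat fps fps" where "q_inner \<equiv> fps_const fps_X"

text \<open>This is the substitution of \<open>x q\<^sup>3\<close> for \<open>x\<close>.\<close>

definition dilate_x :: "rat fps fps \<Rightarrow> rat fps fps" where
  "dilate_x F = Abs_fps (\<lambda>m. fps_X ^ (3 * m) * fps_nth F m)"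

lemma dilate_x_nth [simp]: "fps_nth (dilate_x F) m = fps_X ^ (3 * m) * fps_nth F m"
  by (simp add: dilate_x_def)

definition list_gf :: "nat list set \<Rightarrow> rat fps fps" where
  "list_gf A = Abs_fps (\<lambda>m. Abs_fps (\<lambda>n. of_nat (card {ps \<in> A. length ps = m \<and> sum_list ps = n})))"

lemma list_gf_nth:
  "fps_nth (fps_nth (list_gf A) m) n = of_nat (card {ps \<in> A. length ps = m \<and> sum_list ps = n})"
  by (simp add: list_gf_def)

lemma finite_lists_length_sum: "finite {ps :: nat list. length ps = m \<and> sum_list ps = n}"
proof (rule finite_subset)
  show "{ps. length ps = m \<and> sum_list ps = n} \<subseteq> {ps. set ps \<subseteq> {..n} \<and> length ps = m}"
    by (auto intro: member_le_sum_list)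
qed (rule finite_lists_length_eq, simp)

lemma list_gf_Un:
  assumes "A \<inter> B = {}"
  shows "list_gf (A \<union> B) = list_gf A + list_gf B"
proof (intro fps_ext)
  fix m n
  have "{ps \<in> A \<union> B. length ps = m \<and> sum_list ps = n} =
    {ps \<in> A. length ps = m \<and> sum_list ps = n} \<union> {ps \<in> B. length ps = m \<and> sum_list ps = n}"
    by auto
  moreover have "finite {ps \<in> C. length ps = m \<and> sum_list ps = n}" for C
    by (rule finite_subset[OF _ finite_lists_length_sum[of m n]]) auto
  ultimately show "fps_nth (fps_nth (list_gf (A \<union> B)) m) n = fps_nth (fps_nth (list_gf A + list_gf B) m) n"
    using assms by (simp add: list_gf_nth card_Un_disjoint disjoint_iff)
qed

lemma list_gf_Un3:
  assumes "A \<inter> B = {}" "A \<inter> C = {}" "B \<inter> C = {}"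
  shows "list_gf (A \<union> B \<union> C) = list_gf A + list_gf B + list_gf C"
  using assms by (simp add: list_gf_Un Int_Un_distrib2)

lemma list_gf_Cons: "list_gf (Cons a ` A) = x_outer * q_inner ^ a * list_gf A"
proof (intro fps_ext)
  fix m n
  show "fps_nth (fps_nth (list_gf (Cons a ` A)) m) n =
    fps_nth (fps_nth (x_outer * q_inner ^ a * list_gf A) m) n"
  proof (cases "m = 0 \<or> n < a")
    case True
    then have empty: "{ps \<in> Cons a ` A. length ps = m \<and> sum_list ps = n} = {}"
      by auto
    show ?thesis
      unfolding list_gf_nth empty using True by (auto simp: mult.assoc fps_X_power_mult_nth)
  next
    case False
    then have "{ps \<in> Cons a ` A. length ps = m \<and> sum_list ps = n} =
        Cons a ` {ps \<in> A. length ps = m - 1 \<and> sum_list ps = n - a}"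
      by auto
    with False show ?thesis
      by (simp add: list_gf_nth mult.assoc fps_X_power_mult_nth card_image)
  qed
qed

text \<open>Adding 3 to each of \<open>m\<close> parts multiplies the coefficient of \<open>x\<^sup>m\<close> by \<open>q\<^bsup>3m\<^esup>\<close>.\<close>

lemma list_gf_map_add_3: "list_gf (map (\<lambda>p. p + 3) ` A) = dilate_x (list_gf A)"
proof (intro fps_ext)
  fix m n
  have sum: "sum_list (map (\<lambda>p. p + 3) ps) = sum_list ps + 3 * length ps" for ps :: "nat list"
    by (induction ps) auto
  have inj: "inj_on (map (\<lambda>p :: nat. p + 3)) C" for C
    by (auto intro!: inj_on_mapI inj_onI)
  show "fps_nth (fps_nth (list_gf (map (\<lambda>p. p + 3) ` A)) m) n =
    fps_nth (fps_nth (dilate_x (list_gf A)) m) n"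
  proof (cases "n < 3 * m")
    case True
    then have empty: "{ps \<in> map (\<lambda>p. p + 3) ` A. length ps = m \<and> sum_list ps = n} = {}"
      by (auto simp: sum)
    show ?thesis
      unfolding list_gf_nth empty using True by (simp add: fps_X_power_mult_nth)
  next
    case False
    then have "{ps \<in> map (\<lambda>p. p + 3) ` A. length ps = m \<and> sum_list ps = n} =
        map (\<lambda>p. p + 3) ` {ps \<in> A. length ps = m \<and> sum_list ps = n - 3 * m}"
      by (auto simp: sum)
    with False show ?thesis
      by (simp add: list_gf_nth fps_X_power_mult_nth card_image inj)
  qed
qed

section \<open>The system of functional equations\<close>

text \<open>The dilations stand for the generating functions with lower bounds 5, 6 and 7. A value at
  \<open>x = 0\<close> has to be prescribed because the equations are homogeneous.\<close>

definition kr4_system :: "rat fps fps \<Rightarrow> rat fps fps \<Rightarrow> rat fps fps \<Rightarrow> bool" where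
  "kr4_system F\<^sub>2 F\<^sub>3 F\<^sub>4 \<longleftrightarrow>
     F\<^sub>2 = F\<^sub>3 + x_outer * q_inner ^ 2 * dilate_x F\<^sub>2 + x_outer ^ 2 * q_inner ^ 6 * dilate_x F\<^sub>3
           + x_outer ^ 2 * q_inner ^ 5 * dilate_x F\<^sub>2 \<and>
     F\<^sub>3 = F\<^sub>4 + x_outer * q_inner ^ 3 * dilate_x F\<^sub>2 \<and>
     F\<^sub>4 = dilate_x F\<^sub>2 + x_outer * q_inner ^ 4 * dilate_x F\<^sub>3 + x_outer ^ 2 * q_inner ^ 8 * dilate_x F\<^sub>4 \<and>
     fps_nth F\<^sub>2 0 = 1"

text \<open>All terms with a factor \<open>x\<close> contribute only earlier coefficients to the coefficient of \<open>x\<^sup>m\<close>.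
  Eliminating the third and fourth series leaves \<open>(1 - q\<^bsup>3m\<^esup>) F = r\<close> for the \<open>m\<close>-th coefficient
  \<open>F\<close> of the second one, with \<open>r\<close> known by induction; for \<open>m > 0\<close> the factor can be cancelled.\<close>

lemma kr4_system_unique:
  assumes "kr4_system F\<^sub>2 F\<^sub>3 F\<^sub>4" "kr4_system G\<^sub>2 G\<^sub>3 G\<^sub>4"
  shows "F\<^sub>2 = G\<^sub>2"
proof -
  have "fps_nth F\<^sub>2 m = fps_nth G\<^sub>2 m \<and> fps_nth F\<^sub>3 m = fps_nth G\<^sub>3 m \<and> fps_nth F\<^sub>4 m = fps_nth G\<^sub>4 m" for m
  proof (induction m rule: less_induct)
    case (less m)
    define r\<^sub>2 where "r\<^sub>2 = fps_nth (x_outer * q_inner ^ 2 * dilate_x F\<^sub>2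
      + x_outer ^ 2 * q_inner ^ 6 * dilate_x F\<^sub>3 + x_outer ^ 2 * q_inner ^ 5 * dilate_x F\<^sub>2) m"
    define r\<^sub>3 where "r\<^sub>3 = fps_nth (x_outer * q_inner ^ 3 * dilate_x F\<^sub>2) m"
    define r\<^sub>4 where "r\<^sub>4 = fps_nth (x_outer * q_inner ^ 4 * dilate_x F\<^sub>3
      + x_outer ^ 2 * q_inner ^ 8 * dilate_x F\<^sub>4) m"
    \<comment> \<open>the contributions of earlier coefficients agree by the induction hypothesis\<close>
    have r\<^sub>2: "r\<^sub>2 = fps_nth (x_outer * q_inner ^ 2 * dilate_x G\<^sub>2
      + x_outer ^ 2 * q_inner ^ 6 * dilate_x G\<^sub>3 + x_outer ^ 2 * q_inner ^ 5 * dilate_x G\<^sub>2) m"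
      and r\<^sub>3: "r\<^sub>3 = fps_nth (x_outer * q_inner ^ 3 * dilate_x G\<^sub>2) m"
      and r\<^sub>4: "r\<^sub>4 = fps_nth (x_outer * q_inner ^ 4 * dilate_x G\<^sub>3
      + x_outer ^ 2 * q_inner ^ 8 * dilate_x G\<^sub>4) m"
      unfolding r\<^sub>2_def r\<^sub>3_def r\<^sub>4_def using less.IH
      by (simp_all add: mult.assoc fps_X_power_mult_nth)
    have F: "fps_nth F\<^sub>2 m = fps_nth F\<^sub>3 m + r\<^sub>2" "fps_nth F\<^sub>3 m = fps_nth F\<^sub>4 m + r\<^sub>3"
      "fps_nth F\<^sub>4 m = fps_X ^ (3 * m) * fps_nth F\<^sub>2 m + r\<^sub>4"
      unfolding r\<^sub>2_def r\<^sub>3_def r\<^sub>4_def dilate_x_nth[symmetric] fps_add_nth[symmetric] add.assoc[symmetric]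
      using assms(1) unfolding kr4_system_def by (metis (no_types))+
    have G: "fps_nth G\<^sub>2 m = fps_nth G\<^sub>3 m + r\<^sub>2" "fps_nth G\<^sub>3 m = fps_nth G\<^sub>4 m + r\<^sub>3"
      "fps_nth G\<^sub>4 m = fps_X ^ (3 * m) * fps_nth G\<^sub>2 m + r\<^sub>4"
      unfolding r\<^sub>2 r\<^sub>3 r\<^sub>4 dilate_x_nth[symmetric] fps_add_nth[symmetric] add.assoc[symmetric]
      using assms(2) unfolding kr4_system_def by (metis (no_types))+
    have "fps_nth F\<^sub>2 m = fps_nth G\<^sub>2 m"
    proof (cases "m = 0")
      case True
      with assms show ?thesis by (simp add: kr4_system_def)
    next
      case False
      have "(1 - fps_X ^ (3 * m)) * (fps_nth F\<^sub>2 m - fps_nth G\<^sub>2 m) = 0"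
      proof -
        have "a - c * a = r\<^sub>4 + r\<^sub>3 + r\<^sub>2"
          if "a = b + r\<^sub>2" "b = d + r\<^sub>3" "d = c * a + r\<^sub>4" for a b c d
          using that by algebra
        from this[OF F] this[OF G] show ?thesis
          by (simp add: left_diff_distrib right_diff_distrib)
      qed
      moreover have "1 - fps_X ^ (3 * m) \<noteq> (0 :: rat fps)"
      proof
        assume "1 - fps_X ^ (3 * m) = (0 :: rat fps)"
        then have "fps_nth (1 - fps_X ^ (3 * m) :: rat fps) 0 = 0"
          by simp
        with False show False by simp
      qed
      ultimately show ?thesis by simp
    qed
    moreover from this have "fps_nth F\<^sub>4 m = fps_nth G\<^sub>4 m"
      by (simp only: F(3) G(3))
    moreover from this have "fps_nth F\<^sub>3 m = fps_nth G\<^sub>3 m"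
      by (simp only: F(2) G(2))
    ultimately show ?case by blast
  qed
  then show ?thesis by (simp add: fps_eq_iff)
qed

lemma kr4_system_list_gf:
  "kr4_system (list_gf (admissible_from 2)) (list_gf (admissible_from 3)) (list_gf (admissible_from 4))"
proof -
  have not_from: "admissible_from s \<inter> Cons a ` B = {}" if "a < s" for a s B
    using that by (auto simp: admissible_from_def)
  have Cons_Cons: "Cons a ` B \<inter> Cons a ` C = {}" if "B \<inter> C = {}" for a B and C :: "nat list set"
    using that by auto
  have dilate: "list_gf (admissible_from (s + 3)) = dilate_x (list_gf (admissible_from s))" for s
    by (simp add: admissible_from_add_3 list_gf_map_add_3)
  have dilate_num: "list_gf (admissible_from 5) = dilate_x (list_gf (admissible_from 2))"
    "list_gf (admissible_from 6) = dilate_x (list_gf (admissible_from 3))"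
    "list_gf (admissible_from 7) = dilate_x (list_gf (admissible_from 4))"
    using dilate[of 2] dilate[of 3] dilate[of 4] by simp_all
  have 3: "list_gf (admissible_from 3) = list_gf (admissible_from 4)
      + x_outer * q_inner ^ 3 * list_gf (admissible_from 5)"
    using list_gf_Un[of "admissible_from 4" "Cons 3 ` admissible_from 5"] not_from[of 3 4]
    unfolding admissible_from_3[symmetric] list_gf_Cons by simp
  have 4: "list_gf (admissible_from 4) = list_gf (admissible_from 5)
      + x_outer * q_inner ^ 4 * list_gf (admissible_from 6)
      + x_outer * q_inner ^ 4 * (x_outer * q_inner ^ 4 * list_gf (admissible_from 7))"
  proof -
    have d1: "Cons 4 ` admissible_from 6 \<inter> Cons 4 ` Cons 4 ` admissible_from 7 = {}"
      by (intro Cons_Cons not_from) simp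
    have d: "admissible_from 5 \<inter> Cons 4 ` B = {}" for B
      by (intro not_from) simp
    from list_gf_Un3[OF d d d1] show ?thesis
      unfolding admissible_from_4[symmetric] list_gf_Cons .
  qed
  have 2: "list_gf (admissible_from 2) = list_gf (admissible_from 3)
      + x_outer * q_inner ^ 2 * list_gf (admissible_from 5)
      + x_outer * q_inner ^ 2 * (x_outer * q_inner ^ 4 * list_gf (admissible_from 6))
      + x_outer * q_inner ^ 2 * (x_outer * q_inner ^ 3 * list_gf (admissible_from 5))"
  proof -
    have d1: "Cons 2 ` admissible_from 5 \<inter> Cons 2 ` Cons 4 ` admissible_from 6 = {}"
      by (intro Cons_Cons not_from) simp
    have d2: "Cons 2 ` admissible_from 5 \<inter> Cons 2 ` Cons 3 ` admissible_from 5 = {}"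
      by (intro Cons_Cons not_from) simp
    have d3: "Cons 2 ` Cons 4 ` admissible_from 6 \<inter> Cons 2 ` Cons 3 ` admissible_from 5 = {}"
      by (intro Cons_Cons) auto
    have d: "admissible_from 3 \<inter> Cons 2 ` B = {}" for B
      by (intro not_from) simp
    have "(admissible_from 3 \<union> Cons 2 ` admissible_from 5 \<union> Cons 2 ` Cons 4 ` admissible_from 6)
        \<inter> Cons 2 ` Cons 3 ` admissible_from 5 = {}"
      unfolding Int_Un_distrib2 d d2 d3 by simp
    from list_gf_Un[OF this] show ?thesis
      unfolding admissible_from_2[symmetric] list_gf_Un3[OF d d d1] list_gf_Cons .
  qed
  have "{ps \<in> admissible_from 2. length ps = 0 \<and> sum_list ps = n} = (if n = 0 then {[]} else {})" for n
    by (auto simp: Nil_in_admissible_from)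
  then have "fps_nth (list_gf (admissible_from 2)) 0 = 1"
    by (intro fps_ext) (simp add: list_gf_nth)
  moreover have "x_outer * q_inner ^ i * (x_outer * q_inner ^ j * F) = x_outer ^ 2 * q_inner ^ (i + j) * F"
    for i j F
    by (simp only: power_add power2_eq_square mult_ac)
  from this[of 2 4] this[of 2 3] this[of 4 4]
  have "x_outer * q_inner ^ 2 * (x_outer * q_inner ^ 4 * F) = x_outer ^ 2 * q_inner ^ 6 * F"
    "x_outer * q_inner ^ 2 * (x_outer * q_inner ^ 3 * F) = x_outer ^ 2 * q_inner ^ 5 * F"
    "x_outer * q_inner ^ 4 * (x_outer * q_inner ^ 4 * F) = x_outer ^ 2 * q_inner ^ 8 * F" for F
    by simp_all
  ultimately show ?thesis
    using 2 3 4 unfolding kr4_system_def dilate_num by (simp only:)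
qed

section \<open>The double series satisfies the system\<close>

definition denominator :: "nat \<Rightarrow> nat \<Rightarrow> rat fps" where
  "denominator i j = qpochhammer fps_X fps_X i * qpochhammer (fps_X ^ 3) (fps_X ^ 3) j"

lemma qpochhammer_Suc: "qpochhammer a q (Suc n) = qpochhammer a q n * (1 - a * q ^ n)"
  by (simp add: qpochhammer_def)

lemma denominator_nth_0: "fps_nth (denominator i j) 0 = 1"
proof -
  have "fps_nth (qpochhammer a b n) 0 = 1" if "fps_nth a 0 = 0" for a b :: "rat fps" and n
    by (induction n) (simp_all add: qpochhammer_Suc that, simp add: qpochhammer_def)
  then show ?thesis
    by (simp add: denominator_def)
qed

text \<open>These two cancellations are what makes the index shifts in the double series possible.\<close>

lemma inverse_denominator_Suc_left:
  "(1 - fps_X ^ (i + 1)) * inverse (denominator (i + 1) j) = inverse (denominator i j)"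
proof -
  have "denominator (i + 1) j = (1 - fps_X ^ (i + 1)) * denominator i j"
    by (simp add: denominator_def qpochhammer_Suc mult_ac)
  moreover have "(1 - fps_X ^ (i + 1)) * inverse (1 - fps_X ^ (i + 1) :: rat fps) = 1"
    by (rule inverse_mult_eq_1') simp
  ultimately show ?thesis
    by (simp only: fps_inverse_mult mult.assoc[symmetric] mult_1_left)
qed

lemma inverse_denominator_Suc_right:
  "(1 - fps_X ^ (3 * (j + 1))) * inverse (denominator i (j + 1)) = inverse (denominator i j)"
proof -
  have "(fps_X ^ 3 :: rat fps) * (fps_X ^ 3) ^ j = fps_X ^ (3 * (j + 1))"
    by (simp add: power_mult[symmetric] power_add[symmetric])
  then have "denominator i (j + 1) = (1 - fps_X ^ (3 * (j + 1))) * denominator i j"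
    by (simp only: denominator_def qpochhammer_Suc Suc_eq_plus1[symmetric] mult_ac)
  moreover have "(1 - fps_X ^ (3 * (j + 1))) * inverse (1 - fps_X ^ (3 * (j + 1)) :: rat fps) = 1"
    by (rule inverse_mult_eq_1') simp
  ultimately show ?thesis
    by (simp only: fps_inverse_mult mult.assoc[symmetric] mult_1_left)
qed

definition summand :: "nat \<Rightarrow> nat \<Rightarrow> nat \<Rightarrow> nat \<Rightarrow> rat fps" where
  "summand a b i j = fps_X ^ (3 * j\<^sup>2 + b * j + i\<^sup>2 + a * i + 3 * i * j) * inverse (denominator i j)"

definition double_series :: "nat \<Rightarrow> nat \<Rightarrow> rat fps fps" where
  "double_series a b = Abs_fps (\<lambda>m. \<Sum>(i, j) | i + 2 * j = m. summand a b i j)"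

lemma double_series_nth:
  "fps_nth (double_series a b) m = (\<Sum>(i, j) | i + 2 * j = m. summand a b i j)"
  by (simp add: double_series_def)

lemma finite_exponent_pairs: "finite {(i, j). i + 2 * j = (m :: nat)}"
  by (rule finite_subset[of _ "{..m} \<times> {..m}"]) auto

text \<open>If the summands vanish for small indices, the sum can be reindexed to start at \<open>(k, l)\<close>; the
  degree \<open>i + 2 j\<close> in \<open>x\<close> then drops by \<open>k + 2 l\<close>, which is a multiplication by a power of \<open>x\<close>.\<close>

lemma sum_exponent_pairs_shift:
  fixes f :: "nat \<Rightarrow> nat \<Rightarrow> 'a :: comm_monoid_add"
  assumes "\<And>i j. i < k \<or> j < l \<Longrightarrow> f i j = 0"
  shows "(\<Sum>(i, j) | i + 2 * j = m. f i j) =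
    (if m < k + 2 * l then 0 else \<Sum>(i, j) | i + 2 * j = m - (k + 2 * l). f (i + k) (j + l))"
proof (cases "m < k + 2 * l")
  case True
  have "f i j = 0" if "i + 2 * j = m" for i j
    using that True by (intro assms) linarith
  then have "(\<Sum>(i, j) | i + 2 * j = m. f i j) = 0"
    by (intro sum.neutral ballI) (simp split: prod.splits)
  with True show ?thesis
    by simp
next
  case False
  let ?shift = "\<lambda>(i, j). (i + k, j + l)"
  have "(\<Sum>(i, j) | i + 2 * j = m. f i j) =
      (\<Sum>(i, j)\<in>?shift ` {(i, j). i + 2 * j = m - (k + 2 * l)}. f i j)"
  proof (rule sum.mono_neutral_right[OF finite_exponent_pairs])
    show "?shift ` {(i, j). i + 2 * j = m - (k + 2 * l)} \<subseteq> {(i, j). i + 2 * j = m}"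
      using False by auto
    show "\<forall>p \<in> {(i, j). i + 2 * j = m} - ?shift ` {(i, j). i + 2 * j = m - (k + 2 * l)}.
        (case p of (i, j) \<Rightarrow> f i j) = 0"
    proof
      fix p
      assume p: "p \<in> {(i, j). i + 2 * j = m} - ?shift ` {(i, j). i + 2 * j = m - (k + 2 * l)}"
      obtain i j where ij: "p = (i, j)"
        by fastforce
      have m: "i + 2 * j = m" and notin: "(i, j) \<notin> ?shift ` {(i, j). i + 2 * j = m - (k + 2 * l)}"
        using p by (simp_all add: ij)
      have "i < k \<or> j < l"
      proof (rule ccontr)
        assume "\<not> (i < k \<or> j < l)"
        then obtain i' j' where "i = i' + k" "j = j' + l"
          by (metis add.commute le_Suc_ex not_less)
        with m have "(i, j) = ?shift (i', j')" "i' + 2 * j' = m - (k + 2 * l)"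
          by auto
        with notin show False by blast
      qed
      then show "(case p of (i, j) \<Rightarrow> f i j) = 0"
        by (simp add: ij assms)
    qed
  qed
  also have "\<dots> = (\<Sum>(i, j) | i + 2 * j = m - (k + 2 * l). f (i + k) (j + l))"
    by (subst sum.reindex) (auto intro!: inj_onI sum.cong)
  finally show ?thesis
    using False by simp
qed

text \<open>The difference of the two series has the factor \<open>1 - q\<^sup>i\<close> in its summands: this vanishes at
  \<open>i = 0\<close> and otherwise cancels the last factor of \<open>(q; q)\<^sub>i\<close>, so that \<open>i\<close> can be replaced by
  \<open>i + 1\<close>. Expanding \<open>(i + 1)\<^sup>2 + 3 (i + 1) j\<close> explains the increments 2 and 3.\<close>

lemma double_series_Suc_left:
  "double_series a b = double_series (a + 1) b
     + x_outer * q_inner ^ (a + 1) * double_series (a + 2) (b + 3)"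
proof (rule fps_ext)
  fix m
  have diff: "summand a b i j - summand (a + 1) b i j = (1 - fps_X ^ i) * summand a b i j" for i j
    by (simp add: summand_def algebra_simps power_add)
  have shifted: "(1 - fps_X ^ (i + 1)) * summand a b (i + 1) (j + 0) =
      fps_X ^ (a + 1) * summand (a + 2) (b + 3) i j" for i j
  proof -
    have "3 * j\<^sup>2 + b * j + (i + 1)\<^sup>2 + a * (i + 1) + 3 * (i + 1) * j =
        (a + 1) + (3 * j\<^sup>2 + (b + 3) * j + i\<^sup>2 + (a + 2) * i + 3 * i * j)"
      by (simp add: power2_eq_square algebra_simps)
    moreover have "u * (fps_X ^ (a + 1 + e) * v) = fps_X ^ (a + 1) * (fps_X ^ e * (u * v))"
      for u v :: "rat fps" and e
      by (simp only: power_add mult_ac)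
    ultimately show ?thesis
      by (simp only: summand_def add_0_right inverse_denominator_Suc_left)
  qed
  have "fps_nth (double_series a b - double_series (a + 1) b) m =
      (\<Sum>(i, j) | i + 2 * j = m. (1 - fps_X ^ i) * summand a b i j)"
    unfolding fps_sub_nth double_series_nth sum_subtractf[symmetric] case_prod_unfold diff ..
  also have "\<dots> = fps_nth (x_outer * q_inner ^ (a + 1) * double_series (a + 2) (b + 3)) m"
    by (subst sum_exponent_pairs_shift[where k = 1 and l = 0])
      (simp_all add: shifted[simplified] mult.assoc double_series_nth sum_distrib_left case_prod_unfold)
  finally show "fps_nth (double_series a b) m = fps_nth (double_series (a + 1) b
      + x_outer * q_inner ^ (a + 1) * double_series (a + 2) (b + 3)) m"
    by (simp add: diff_eq_eq add.commute)
qed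

text \<open>The same argument for the other index, with the factor \<open>1 - q\<^bsup>3j\<^esup>\<close> and the last factor of
  \<open>(q\<^sup>3; q\<^sup>3)\<^sub>j\<close>; now \<open>3 (j + 1)\<^sup>2 + 3 i (j + 1)\<close> accounts for the increments 6 and 3.\<close>

lemma double_series_add_3_right:
  "double_series a b = double_series a (b + 3)
     + x_outer ^ 2 * q_inner ^ (b + 3) * double_series (a + 3) (b + 6)"
proof (rule fps_ext)
  fix m
  have diff: "summand a b i j - summand a (b + 3) i j = (1 - fps_X ^ (3 * j)) * summand a b i j" for i j
    by (simp add: summand_def algebra_simps power_add)
  have shifted: "(1 - fps_X ^ (3 * (j + 1))) * summand a b (i + 0) (j + 1) =
      fps_X ^ (b + 3) * summand (a + 3) (b + 6) i j" for i j
  proof -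
    have "3 * (j + 1)\<^sup>2 + b * (j + 1) + i\<^sup>2 + a * i + 3 * i * (j + 1) =
        (b + 3) + (3 * j\<^sup>2 + (b + 6) * j + i\<^sup>2 + (a + 3) * i + 3 * i * j)"
      by (simp add: power2_eq_square algebra_simps)
    moreover have "u * (fps_X ^ (b + 3 + e) * v) = fps_X ^ (b + 3) * (fps_X ^ e * (u * v))"
      for u v :: "rat fps" and e
      by (simp only: power_add mult_ac)
    ultimately show ?thesis
      by (simp only: summand_def add_0_right inverse_denominator_Suc_right)
  qed
  have "fps_nth (double_series a b - double_series a (b + 3)) m =
      (\<Sum>(i, j) | i + 2 * j = m. (1 - fps_X ^ (3 * j)) * summand a b i j)"
    unfolding fps_sub_nth double_series_nth sum_subtractf[symmetric] case_prod_unfold diff ..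
  also have "\<dots> = fps_nth (x_outer ^ 2 * q_inner ^ (b + 3) * double_series (a + 3) (b + 6)) m"
    by (subst sum_exponent_pairs_shift[where k = 0 and l = 1])
      (simp_all add: shifted[simplified] mult.assoc fps_X_power_mult_nth double_series_nth numeral_2_eq_2[symmetric]
        sum_distrib_left case_prod_unfold)
  finally show "fps_nth (double_series a b) m = fps_nth (double_series a (b + 3)
      + x_outer ^ 2 * q_inner ^ (b + 3) * double_series (a + 3) (b + 6)) m"
    by (simp add: diff_eq_eq add.commute)
qed

lemma dilate_x_double_series: "dilate_x (double_series a b) = double_series (a + 3) (b + 6)"
proof (rule fps_ext)
  fix m
  have "fps_X ^ (3 * (i + 2 * j)) * summand a b i j = summand (a + 3) (b + 6) i j" for i j
  proof -
    have "3 * (i + 2 * j) + (3 * j\<^sup>2 + b * j + i\<^sup>2 + a * i + 3 * i * j) =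
        3 * j\<^sup>2 + (b + 6) * j + i\<^sup>2 + (a + 3) * i + 3 * i * j"
      by (simp add: algebra_simps)
    then show ?thesis
      by (simp only: summand_def mult.assoc[symmetric] power_add[symmetric])
  qed
  then show "fps_nth (dilate_x (double_series a b)) m = fps_nth (double_series (a + 3) (b + 6)) m"
    by (auto simp: double_series_nth sum_distrib_left intro!: sum.cong)
qed

lemma kr4_system_double_series:
  "kr4_system (double_series 1 2) (double_series 2 5) (double_series 3 5)"
proof -
  note i = double_series_Suc_left and j = double_series_add_3_right
  have "double_series 1 2 = double_series 2 5 + x_outer * q_inner ^ 2 * double_series 4 8
      + x_outer ^ 2 * q_inner ^ 6 * double_series 5 11 + x_outer ^ 2 * q_inner ^ 5 * double_series 4 8"
  proof -
    \<comment> \<open>Five uses of the contiguity relations. When both sides are expanded, \<open>G\<close> occurs with the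
      factor \<open>x q\<^sup>2 \<cdot> x\<^sup>2 q\<^sup>8\<close> on the left and \<open>x\<^sup>2 q\<^sup>5 \<cdot> x q\<^sup>5\<close> on the right; these agree.\<close>
    have "A = D + x * q ^ 2 * H + x ^ 2 * q ^ 6 * I + x ^ 2 * q ^ 5 * H"
      if "A = B + x * q ^ 2 * C" "B = D + x ^ 2 * q ^ 5 * E" "C = F + x ^ 2 * q ^ 8 * G"
        "F = H + x * q ^ 4 * I" "H = E + x * q ^ 5 * G" for A B C D E F G H I x q :: "rat fps fps"
      unfolding that by (simp add: algebra_simps power_numeral_reduce)
    moreover have "double_series 1 2 = double_series 2 2 + x_outer * q_inner ^ 2 * double_series 3 5"
      using i[of 1 2] by (simp del: fps_const_power One_nat_def)
    moreover have "double_series 2 2 = double_series 2 5 + x_outer ^ 2 * q_inner ^ 5 * double_series 5 8"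
      using j[of 2 2] by (simp del: fps_const_power)
    moreover have "double_series 3 5 = double_series 3 8 + x_outer ^ 2 * q_inner ^ 8 * double_series 6 11"
      using j[of 3 5] by (simp del: fps_const_power)
    moreover have "double_series 3 8 = double_series 4 8 + x_outer * q_inner ^ 4 * double_series 5 11"
      using i[of 3 8] by (simp del: fps_const_power)
    moreover have "double_series 4 8 = double_series 5 8 + x_outer * q_inner ^ 5 * double_series 6 11"
      using i[of 4 8] by (simp del: fps_const_power)
    ultimately show ?thesis by blast
  qed
  moreover have "double_series 2 5 = double_series 3 5 + x_outer * q_inner ^ 3 * double_series 4 8"
    using i[of 2 5] by simp
  moreover have "double_series 3 5 = double_series 4 8 + x_outer * q_inner ^ 4 * double_series 5 11
      + x_outer ^ 2 * q_inner ^ 8 * double_series 6 11"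
    using j[of 3 5] i[of 3 8] by simp
  moreover have "{(i, j). i + 2 * j = (0 :: nat)} = {(0, 0)}"
    by auto
  then have "fps_nth (double_series 1 2) 0 = 1"
    by (simp add: double_series_nth summand_def denominator_def qpochhammer_def)
  ultimately show ?thesis
    using dilate_x_double_series[of 1 2] dilate_x_double_series[of 2 5] dilate_x_double_series[of 3 5]
    by (simp add: kr4_system_def)
qed

section \<open>Summation in the q-adic topology\<close>

lemma list_gf_admissible_eq_double_series: "list_gf (admissible_from 2) = double_series 1 2"
  using kr4_system_unique kr4_system_list_gf kr4_system_double_series by blast

lemma kr4_eq_sum:
  "of_nat (kr4 n m) = (\<Sum>(i, j) | i + 2 * j = m. fps_nth (summand 1 2 i j) n)"
proof -
  have "kr4_partitions n m = {ps \<in> admissible_from 2. length ps = m \<and> sum_list ps = n}"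
    by (fastforce simp: kr4_partitions_def is_partition_def admissible_from_def admissible_iff)
  then have "of_nat (kr4 n m) = fps_nth (fps_nth (list_gf (admissible_from 2)) m) n"
    by (simp add: kr4_def list_gf_nth)
  also have "\<dots> = (\<Sum>(i, j) | i + 2 * j = m. fps_nth (summand 1 2 i j) n)"
    by (simp add: list_gf_admissible_eq_double_series double_series_nth fps_sum_nth case_prod_unfold)
  finally show ?thesis .
qed

text \<open>The embedding of the univariate series in \<open>q\<close> into the bivariate ones with \<open>q\<close> as the outer
  variable.\<close>

definition lift_q :: "rat fps \<Rightarrow> rat fps fps" where
  "lift_q f = Abs_fps (\<lambda>n. fps_const (fps_nth f n))"

lemma lift_q_nth [simp]: "fps_nth (lift_q f) n = fps_const (fps_nth f n)"
  by (simp add: lift_q_def)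

lemma lift_q_mult: "lift_q (f * g) = lift_q f * lift_q g"
  by (intro fps_ext) (simp add: fps_mult_nth fps_sum_nth)

lemma lift_q_diff: "lift_q (f - g) = lift_q f - lift_q g"
  by (intro fps_ext) simp

lemma lift_q_1: "lift_q 1 = 1"
  by (intro fps_ext) simp

lemma lift_q_power: "lift_q (f ^ n) = lift_q f ^ n"
  by (induction n) (simp_all add: lift_q_1 lift_q_mult)

lemma lift_q_X: "lift_q fps_X = q_var"
  by (intro fps_ext) (simp add: q_var_def)

lemma lift_q_qpochhammer: "lift_q (qpochhammer a b n) = qpochhammer (lift_q a) (lift_q b) n"
  by (induction n) (simp_all add: qpochhammer_Suc lift_q_mult lift_q_diff lift_q_power lift_q_1,
      simp add: qpochhammer_def lift_q_1)

text \<open>The denominators are non-zero in an integral domain, so it is enough to compare both sides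
  after multiplication by them.\<close>

lemma double_series_term_eq:
  "q_var ^ (3 * j\<^sup>2 + 2 * j + i\<^sup>2 + i + 3 * i * j) * x_var ^ (2 * j + i)
     / (qpochhammer q_var q_var i * qpochhammer (q_var ^ 3) (q_var ^ 3) j)
   = lift_q (summand 1 2 i j) * x_var ^ (2 * j + i)" (is "?N / ?D = ?R")
proof -
  have D: "?D = lift_q (denominator i j)"
    by (simp add: denominator_def lift_q_mult lift_q_qpochhammer lift_q_power lift_q_X)
  have "fps_nth (fps_nth ?D 0) 0 = 1"
    by (simp add: D denominator_nth_0)
  then have "?D \<noteq> 0"
    by (metis fps_zero_nth zero_neq_one)
  moreover have "?N / ?D * ?D = ?R * ?D"
  proof -
    have "inverse (denominator i j) * denominator i j = 1"
      by (rule inverse_mult_eq_1) (simp add: denominator_nth_0)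
    then have "summand 1 2 i j * denominator i j = fps_X ^ (3 * j\<^sup>2 + 2 * j + i\<^sup>2 + i + 3 * i * j)"
      by (simp add: summand_def mult.assoc)
    then have "lift_q (summand 1 2 i j) * ?D = q_var ^ (3 * j\<^sup>2 + 2 * j + i\<^sup>2 + i + 3 * i * j)"
      by (simp only: D lift_q_mult[symmetric] lift_q_power lift_q_X)
    moreover have "?R * ?D = lift_q (summand 1 2 i j) * ?D * x_var ^ (2 * j + i)"
      by (simp only: mult_ac)
    ultimately show ?thesis
      by (simp only: qpochhammer_quotients)
  qed
  ultimately show ?thesis
    by simp
qed

text \<open>In the topology of formal power series, convergence means that each coefficient is eventually
  constant; the coefficient of degree \<open>n\<close> is so once all indices in \<open>K n\<close> are included.\<close>

lemma has_sum_fpsI: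
  fixes f :: "'i \<Rightarrow> 'a :: ab_group_add fps"
  assumes "\<And>n. finite (K n)" "\<And>n i. i \<notin> K n \<Longrightarrow> fps_nth (f i) n = 0"
    and "\<And>n. (\<Sum>i\<in>K n. fps_nth (f i) n) = fps_nth S n"
  shows "(f has_sum S) UNIV"
  unfolding has_sum_def
proof (rule tendsto_fpsI)
  fix n
  have "fps_nth (sum f F) n = fps_nth S n" if "finite F" "K n \<subseteq> F" for F
    unfolding fps_sum_nth assms(3)[symmetric]
    using that assms(2) by (intro sum.mono_neutral_right) auto
  then show "\<forall>\<^sub>F F in finite_subsets_at_top UNIV. fps_nth (sum f F) n = fps_nth S n"
    unfolding eventually_finite_subsets_at_top using assms(1) by blast
qed

lemma kr4_eq_0: "n < m \<Longrightarrow> kr4 n m = 0"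
proof -
  assume "n < m"
  have "length ps \<le> sum_list ps" if "\<forall>p \<in> set ps. 0 < p" for ps :: "nat list"
    using that by (induction ps) auto
  with \<open>n < m\<close> have "kr4_partitions n m = {}"
    by (force simp: kr4_partitions_def is_partition_def)
  then show "kr4 n m = 0"
    by (simp add: kr4_def)
qed

text \<open>The quadratic exponent makes the double sum converge: only finitely many summands contribute
  to a given power of \<open>q\<close>.\<close>

lemma summand_nth_nonzero:
  assumes "fps_nth (summand a b i j) n \<noteq> 0"
  shows "i \<le> n \<and> j \<le> n"
proof -
  have "3 * j\<^sup>2 + b * j + i\<^sup>2 + a * i + 3 * i * j \<le> n"
    using assms by (auto simp: summand_def fps_X_power_mult_nth split: if_splits)
  moreover have "i \<le> i\<^sup>2" "j \<le> j\<^sup>2"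
    by (simp_all add: power2_eq_square)
  ultimately show ?thesis
    by linarith
qed

theorem theorem10:
  shows "\<exists>S.
    ((\<lambda>(n, m). of_nat (kr4 n m) * q_var ^ n * x_var ^ m) has_sum S) (UNIV :: (nat \<times> nat) set) \<and>
    ((\<lambda>(n\<^sub>1, n\<^sub>2).
        q_var ^ (3 * n\<^sub>2\<^sup>2 + 2 * n\<^sub>2 + n\<^sub>1\<^sup>2 + n\<^sub>1 + 3 * n\<^sub>1 * n\<^sub>2) * x_var ^ (2 * n\<^sub>2 + n\<^sub>1)
          / (qpochhammer q_var q_var n\<^sub>1 * qpochhammer (q_var ^ 3) (q_var ^ 3) n\<^sub>2))
      has_sum S) (UNIV :: (nat \<times> nat) set)"
proof -
  define S :: "rat fps fps" where "S = Abs_fps (\<lambda>n. Abs_fps (\<lambda>m. of_nat (kr4 n m)))"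
  have S_nth: "fps_nth (fps_nth S n) m = of_nat (kr4 n m)" for n m
    by (simp add: S_def)
  have lhs_nth: "fps_nth (of_nat (kr4 n m) * q_var ^ n * x_var ^ m) k =
      (if k = n then of_nat (kr4 n m) * fps_X ^ m else 0)" for n m k
    by (simp add: q_var_def x_var_def fps_of_nat[symmetric] mult.assoc fps_X_power_mult_nth)
  have "((\<lambda>(n, m). of_nat (kr4 n m) * q_var ^ n * x_var ^ m) has_sum S) UNIV"
  proof (rule has_sum_fpsI[where K = "\<lambda>k. {k} \<times> {..k}"])
    fix k
    show "(\<Sum>p\<in>{k} \<times> {..k}. fps_nth (case p of (n, m) \<Rightarrow> of_nat (kr4 n m) * q_var ^ n * x_var ^ m) k)
        = fps_nth S k"
    proof (rule fps_ext)
      fix l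
      have "(\<Sum>m\<le>k. fps_nth (of_nat (kr4 k m) * fps_X ^ m :: rat fps) l) =
          (\<Sum>m\<le>k. if m = l then of_nat (kr4 k l) else 0)"
        by (intro sum.cong) (auto simp: fps_of_nat[symmetric])
      also have "\<dots> = of_nat (kr4 k l)"
        by (simp add: kr4_eq_0)
      finally show "fps_nth (\<Sum>p\<in>{k} \<times> {..k}.
          fps_nth (case p of (n, m) \<Rightarrow> of_nat (kr4 n m) * q_var ^ n * x_var ^ m) k) l = fps_nth (fps_nth S k) l"
        by (simp add: sum.cartesian_product' lhs_nth S_nth fps_sum_nth)
    qed
    fix p :: "nat \<times> nat"
    assume "p \<notin> {k} \<times> {..k}"
    then show "fps_nth (case p of (n, m) \<Rightarrow> of_nat (kr4 n m) * q_var ^ n * x_var ^ m) k = 0"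
      by (cases p) (auto simp: lhs_nth kr4_eq_0 not_le)
  qed simp
  moreover have "((\<lambda>(i, j). lift_q (summand 1 2 i j) * x_var ^ (2 * j + i)) has_sum S) UNIV"
  proof (rule has_sum_fpsI[where K = "\<lambda>k. {..k} \<times> {..k}"])
    fix k
    show "(\<Sum>p\<in>{..k} \<times> {..k}. fps_nth (case p of (i, j) \<Rightarrow>
        lift_q (summand 1 2 i j) * x_var ^ (2 * j + i)) k) = fps_nth S k"
    proof (rule fps_ext)
      fix l
      have "fps_nth (\<Sum>p\<in>{..k} \<times> {..k}. fps_nth (case p of (i, j) \<Rightarrow>
          lift_q (summand 1 2 i j) * x_var ^ (2 * j + i)) k) l =
        (\<Sum>(i, j)\<in>{..k} \<times> {..k}. if i + 2 * j = l then fps_nth (summand 1 2 i j) k else 0)"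
        by (auto simp: fps_sum_nth x_var_def intro!: sum.cong)
      also have "\<dots> = (\<Sum>(i, j) | i + 2 * j = l. fps_nth (summand 1 2 i j) k)"
        by (rule sum.mono_neutral_cong[OF finite_exponent_pairs])
          (auto dest: summand_nth_nonzero)
      finally show "fps_nth (\<Sum>p\<in>{..k} \<times> {..k}. fps_nth (case p of (i, j) \<Rightarrow>
          lift_q (summand 1 2 i j) * x_var ^ (2 * j + i)) k) l = fps_nth (fps_nth S k) l"
        by (simp add: S_nth kr4_eq_sum)
    qed
  qed (auto simp: x_var_def dest: summand_nth_nonzero)
  ultimately show ?thesis
    unfolding double_series_term_eq by blast
qed

end
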